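(* Let $D_1=\{z_{1,1},\ldots,z_{1,n}\}$ be a collection of $n$ data sources, let $D_2=\{z_{2,1},\ldots,z_{2,n}\}$ be an exact duplicate, i.e. $\mathrm{Ins}(z_{2,i})=\mathrm{Ins}(z_{1,i})$ for all $i\in\{1,\dots,n\}$, and let $D^{\mathrm{dup}}:=D_1\cup D_2$, so that each source is duplicated once. Fix a loss function $L$ and a hypothesis class $\mathcal H$. For any finite collection $S$ of data sources, define empirical risk minimization over data instances by $$R_{\mathcal A}(\mathrm{Ins}(S)):=\frac{1}{|\mathrm{Ins}(S)|}\sum_{(x,y)\in\mathrm{Ins}(S)}L(\mathcal A(x),y),\qquad \mathcal A_S\in\arg\min_{\mathcal A\in\mathcal H}R_{\mathcal A}(\mathrm{Ins}(S)),$$ and let $v(S)$ be the utility of the trained model $\mathcal A_S$. Let $\phi(z;v,D^{\mathrm{dup}})$ be the Data Shapley value of $z\in D^{\mathrm{dup}}$. Then for every $i\in\{1,\dots,n\}$, $\phi(z_{1,i};v,D^{\mathrm{dup}})=\phi(z_{2,i};v,D^{\mathrm{dup}})$, and $$\sum_{z\in D_1}\phi(z;v,D^{\mathrm{dup}})=\sum_{z\in D_2}\phi(z;v,D^{\mathrm{dup}})=\tfrac12\sum_{z\in D^{\mathrm{dup}}}\phi(z;v,D^{\mathrm{dup}})=\tfrac12\bigl(v(D_1)-v(\varnothing)\bigr).$$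
   Context: A data source $z$ is a finite collection of labeled instances $(x,y)$, denoted $\mathrm{Ins}(z)$, repeated instances being allowed. For a collection $S$ of sources, $\mathrm{Ins}(S)$ is the union of the $\mathrm{Ins}(z)$, $z\in S$, with multiplicities added; $|\mathrm{Ins}(S)|$ and the sum over $\mathrm{Ins}(S)$ count multiplicity. The $2n$ sources $z_{1,i},z_{2,i}$ count as different elements of $D^{\mathrm{dup}}$ even though their contents coincide in pairs. Utility: $v:2^{D^{\mathrm{dup}}}\to\mathbb{R}$, where $v(S)$ evaluates the model trained on $S$, here the empirical risk minimizer $\mathcal A_S$ (for example, by its accuracy on a fixed holdout set); $v(\varnothing)$ is the utility assigned to the empty collection. Data Shapley value: for a finite collection $D$ of $N$ sources and $v:2^D\to\mathbb{R}$, $$\phi(z;v,D)=\frac1N\sum_{S\subseteq D\setminus\{z\}}\binom{N-1}{|S|}^{-1}\bigl[v(S\cup\{z\})-v(S)\bigr].$$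
   Formalization: The choice of A_S among several minimizers is assumed consistent: nonempty collections S, T inducing the same empirical risk function on H get the same trained model. With arbitrary tie-breaking the claim is false (e.g. n=1, zero loss, two hypotheses of different utility). *)

theory Defs
  imports Complex_Main "HOL-Library.Multiset"
begin

text \<open>A source is an element of an arbitrary type \<open>'s\<close>, and \<open>ins z\<close> is the multiset of labelled
  instances it contains.  Sources are kept apart from their contents, so two different sources may
  well contain the same instances.\<close>

definition instances :: "('s \<Rightarrow> ('x \<times> 'y) multiset) \<Rightarrow> 's set \<Rightarrow> ('x \<times> 'y) multiset" where
  "instances ins S = (\<Sum>z\<in>S. ins z)"

text \<open>Predictions \<open>'p\<close> and labels \<open>'y\<close> may have different types.  On the empty multiset the risk is
  \<open>0 / 0 = 0\<close>, so every hypothesis is then a minimizer.\<close>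

definition emp_risk ::
    "('p \<Rightarrow> 'y \<Rightarrow> real) \<Rightarrow> ('x \<times> 'y) multiset \<Rightarrow> ('x \<Rightarrow> 'p) \<Rightarrow> real" where
  "emp_risk L M h = 1 / real (size M) * (\<Sum>(x, y)\<in>#M. L (h x) y)"

definition data_shapley :: "('s set \<Rightarrow> real) \<Rightarrow> 's set \<Rightarrow> 's \<Rightarrow> real" where
  "data_shapley v D z =
     1 / real (card D) *
     (\<Sum>S\<in>Pow (D - {z}).
        inverse (real ((card D - 1) choose card S)) * (v (S \<union> {z}) - v S))"

end

theory Submission
  imports Defs "HOL-Combinatorics.Transposition"
begin

text \<open>Duplicate sources are interchangeable: swapping them inside a collection leaves its multiset of
  instances, hence its empirical risk and its trained model, unchanged, so the symmetry of the
  Shapley value applies. By efficiency the total value is \<open>v Ddup - v {}\<close>, and \<open>v Ddup = v D1\<close>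
  because doubling every instance does not change the average loss.\<close>

lemma data_shapley_permute:
  assumes \<sigma>: "bij_betw \<sigma> D D" and z: "z \<in> D"
    and inv: "\<And>T. T \<subseteq> D \<Longrightarrow> v (\<sigma> ` T) = v T"
  shows "data_shapley v D (\<sigma> z) = data_shapley v D z"
proof -
  have inj: "inj_on \<sigma> D" and im: "\<sigma> ` D = D"
    using \<sigma> by (auto simp: bij_betw_def)
  have "\<sigma> ` (D - {z}) = D - {\<sigma> z}"
    using inj_on_image_set_diff[OF inj, of D "{z}"] im z by auto
  then have "bij_betw \<sigma> (D - {z}) (D - {\<sigma> z})"
    using inj by (auto simp: bij_betw_def intro: inj_on_subset)
  then have "bij_betw (image \<sigma>) (Pow (D - {z})) (Pow (D - {\<sigma> z}))"
    by (rule bij_betw_Pow)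
  then have "(\<Sum>S\<in>Pow (D - {\<sigma> z}).
        inverse (real ((card D - 1) choose card S)) * (v (S \<union> {\<sigma> z}) - v S)) =
      (\<Sum>S\<in>Pow (D - {z}).
        inverse (real ((card D - 1) choose card (\<sigma> ` S))) * (v (\<sigma> ` S \<union> {\<sigma> z}) - v (\<sigma> ` S)))"
    by (rule sum.reindex_bij_betw[symmetric])
  also have "\<dots> = (\<Sum>S\<in>Pow (D - {z}).
        inverse (real ((card D - 1) choose card S)) * (v (S \<union> {z}) - v S))"
  proof (rule sum.cong[OF refl])
    fix S assume "S \<in> Pow (D - {z})"
    then have S: "S \<subseteq> D" by auto
    have "v (\<sigma> ` S \<union> {\<sigma> z}) = v (S \<union> {z})"
      using inv[of "S \<union> {z}"] S z by simp
    moreover have "card (\<sigma> ` S) = card S"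
      using inj S by (meson card_image inj_on_subset)
    ultimately show "inverse (real ((card D - 1) choose card (\<sigma> ` S))) *
          (v (\<sigma> ` S \<union> {\<sigma> z}) - v (\<sigma> ` S)) =
        inverse (real ((card D - 1) choose card S)) * (v (S \<union> {z}) - v S)"
      using inv[OF S] by simp
  qed
  finally show ?thesis by (simp add: data_shapley_def)
qed

text \<open>Both sides are \<open>t! (N - t)! / (N - 1)!\<close>. In the efficiency proof this
  cancels the contributions to a proper nonempty \<open>T\<close> from its \<open>t\<close> members
  against those from its \<open>N - t\<close> nonmembers.\<close>

lemma binomial_weight_balance:
  assumes "0 < t" "t < N"
  shows "real t * inverse (real ((N - 1) choose (t - 1))) =
    real (N - t) * inverse (real ((N - 1) choose t))"
proof -
  obtain k m where t: "t = Suc k" and N: "N = Suc m"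
    using assms by (metis gr0_implies_Suc less_trans)
  with assms have k: "k < m" by simp
  \<comment> \<open>By the two absorption identities, both sides equal
    \<open>m * ((m - 1) choose k)\<close>.\<close>
  have "Suc k * (m choose Suc k) = (m - k) * (m choose k)"
    using binomial_absorb_comp[of m k] binomial_absorption[of k "m"] by simp
  then have "real (Suc k) * real (m choose Suc k) = real (m - k) * real (m choose k)"
    by (metis of_nat_mult)
  moreover have "real (m choose k) > 0" "real (m choose Suc k) > 0"
    using k by simp_all
  ultimately show ?thesis
    unfolding t N by (simp add: field_simps del: of_nat_Suc binomial_Suc_Suc)
qed

text \<open>Double counting: exchange the sums over sources and collections, collect the coefficient
  of each \<open>v T\<close>, and see that it vanishes except at the two extremes.\<close>

theorem data_shapley_efficiency:
  assumes fin: "finite D"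
  shows "(\<Sum>z\<in>D. data_shapley v D z) = v D - v {}"
proof (cases "D = {}")
  case True
  then show ?thesis by simp
next
  case False
  define N where "N = card D"
  define w where "w k = inverse (real ((N - 1) choose k))" for k
  have N: "N > 0" using False fin by (simp add: N_def card_gt_0_iff)
  \<comment> \<open>Substituting \<open>T = S \<union> {z}\<close> turns \<open>card S\<close> into
    \<open>card T - 1\<close>; after the exchange, each \<open>T\<close> is counted once per
    member.\<close>
  have "(\<Sum>z\<in>D. \<Sum>S\<in>Pow (D - {z}). w (card S) * v (S \<union> {z})) =
      (\<Sum>z\<in>D. \<Sum>T\<in>{T\<in>Pow D. z \<in> T}. w (card T - 1) * v T)"
  proof (rule sum.cong[OF refl])
    fix z assume z: "z \<in> D"
    show "(\<Sum>S\<in>Pow (D - {z}). w (card S) * v (S \<union> {z})) =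
      (\<Sum>T\<in>{T\<in>Pow D. z \<in> T}. w (card T - 1) * v T)"
    proof (rule sum.reindex_bij_witness[of _ "\<lambda>T. T - {z}" "\<lambda>S. S \<union> {z}"])
      fix S assume "S \<in> Pow (D - {z})"
      then have "finite S" "z \<notin> S"
        using fin by (auto intro: finite_subset)
      then show "w (card (S \<union> {z}) - 1) * v (S \<union> {z}) = w (card S) * v (S \<union> {z})"
        by simp
    qed (use z in auto)
  qed
  also have "\<dots> = (\<Sum>T\<in>Pow D. \<Sum>z\<in>{z\<in>D. z \<in> T}. w (card T - 1) * v T)"
    using fin by (intro sum.swap_restrict) auto
  also have "\<dots> = (\<Sum>T\<in>Pow D. real (card T) * w (card T - 1) * v T)"
  proof (rule sum.cong[OF refl])
    fix T assume "T \<in> Pow D"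
    then have "{z\<in>D. z \<in> T} = T" by auto
    then show "(\<Sum>z\<in>{z\<in>D. z \<in> T}. w (card T - 1) * v T) = real (card T) * w (card T - 1) * v T"
      by simp
  qed
  finally have plus: "(\<Sum>z\<in>D. \<Sum>S\<in>Pow (D - {z}). w (card S) * v (S \<union> {z})) =
      (\<Sum>T\<in>Pow D. real (card T) * w (card T - 1) * v T)" .
  have "(\<Sum>z\<in>D. \<Sum>S\<in>Pow (D - {z}). w (card S) * v S) =
      (\<Sum>z\<in>D. \<Sum>S\<in>{S\<in>Pow D. z \<notin> S}. w (card S) * v S)"
    by (intro sum.cong) auto
  also have "\<dots> = (\<Sum>S\<in>Pow D. \<Sum>z\<in>{z\<in>D. z \<notin> S}. w (card S) * v S)"
    using fin by (intro sum.swap_restrict) auto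
  also have "\<dots> = (\<Sum>S\<in>Pow D. real (N - card S) * w (card S) * v S)"
  proof (rule sum.cong[OF refl])
    fix S assume "S \<in> Pow D"
    then have "card {z\<in>D. z \<notin> S} = N - card S"
      using fin by (simp add: N_def set_diff_eq[symmetric] card_Diff_subset finite_subset)
    then show "(\<Sum>z\<in>{z\<in>D. z \<notin> S}. w (card S) * v S) = real (N - card S) * w (card S) * v S"
      by simp
  qed
  finally have minus: "(\<Sum>z\<in>D. \<Sum>S\<in>Pow (D - {z}). w (card S) * v S) =
      (\<Sum>S\<in>Pow D. real (N - card S) * w (card S) * v S)" .
  \<comment> \<open>The net coefficient of \<open>v T\<close> in \<open>N\<close> times the total
    Shapley value.\<close>
  define c where "c T = real (card T) * w (card T - 1) - real (N - card T) * w (card T)" for T :: "'a set"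
  have c0: "c T = 0" if "T \<in> Pow D - {{}, D}" for T
  proof -
    have "0 < card T" "card T < N"
      using that fin by (auto simp: N_def card_gt_0_iff finite_subset psubset_card_mono psubset_eq)
    then show ?thesis
      using binomial_weight_balance by (simp add: c_def w_def)
  qed
  \<comment> \<open>At each extreme one factor \<open>real (N - card T)\<close> or
    \<open>real (card T)\<close> is zero, so the truncated \<open>card T - 1\<close> at
    \<open>{}\<close> is harmless; the remaining binomial is 1.\<close>
  have cD: "c D = real N" and ce: "c {} = - real N"
    by (simp_all add: c_def w_def N_def)
  have "real N * (\<Sum>z\<in>D. data_shapley v D z) =
      (\<Sum>z\<in>D. \<Sum>S\<in>Pow (D - {z}). w (card S) * (v (S \<union> {z}) - v S))"
    using N by (simp add: data_shapley_def sum_distrib_left w_def flip: N_def)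
  also have "\<dots> = (\<Sum>T\<in>Pow D. c T * v T)"
    using plus minus by (simp add: right_diff_distrib left_diff_distrib sum_subtractf c_def)
  also have "\<dots> = (\<Sum>T\<in>{{}, D}. c T * v T)"
    using fin c0 by (intro sum.mono_neutral_right) auto
  also have "\<dots> = real N * (v D - v {})"
    using False cD ce by (simp add: algebra_simps)
  finally show ?thesis using N by simp
qed

text \<open>The loss sum and the number of instances both double; on the empty multiset both risks
  are 0.\<close>

lemma emp_risk_double: "emp_risk L (M + M) h = emp_risk L M h"
  by (simp add: emp_risk_def)

lemma instances_transpose:
  assumes "ins a = ins b"
  shows "instances ins (transpose a b ` S) = instances ins S"
proof -
  have "instances ins (transpose a b ` S) = (\<Sum>z\<in>S. ins (transpose a b z))"
    unfolding instances_def by (subst sum.reindex) (auto intro: inj_on_subset[OF inj_transpose])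
  also have "\<dots> = instances ins S"
    unfolding instances_def using assms by (intro sum.cong) (auto simp: transpose_def)
  finally show ?thesis .
qed

theorem lemma3p1:
  fixes n :: nat
    and z1 z2 :: "nat \<Rightarrow> 's"
    and D1 D2 Ddup :: "'s set"
    and ins :: "'s \<Rightarrow> ('x \<times> 'y) multiset"
    and L :: "'p \<Rightarrow> 'y \<Rightarrow> real"
    and H :: "('x \<Rightarrow> 'p) set"
    and A :: "'s set \<Rightarrow> ('x \<Rightarrow> 'p)"
    and u :: "('x \<Rightarrow> 'p) \<Rightarrow> real"
    and v :: "'s set \<Rightarrow> real"
  assumes D1: "D1 = z1 ` {1..n}" "inj_on z1 {1..n}"
    and D2: "D2 = z2 ` {1..n}" "inj_on z2 {1..n}"
    and disj: "D1 \<inter> D2 = {}"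
    and Ddup: "Ddup = D1 \<union> D2"
    and dup: "\<And>i. i \<in> {1..n} \<Longrightarrow> ins (z2 i) = ins (z1 i)"
    \<comment> \<open>the model trained on a nonempty collection is an empirical risk minimizer\<close>
    and erm: "\<And>S. S \<subseteq> Ddup \<Longrightarrow> S \<noteq> {} \<Longrightarrow>
          is_arg_min (emp_risk L (instances ins S)) (\<lambda>h. h \<in> H) (A S)"
    \<comment> \<open>ties between minimizers are broken consistently: the trained model is
        determined by the objective being minimized over the hypothesis class\<close>
    and ties: "\<And>S T. S \<subseteq> Ddup \<Longrightarrow> S \<noteq> {} \<Longrightarrow> T \<subseteq> Ddup \<Longrightarrow> T \<noteq> {} \<Longrightarrow>
          (\<And>h. h \<in> H \<Longrightarrow>
             emp_risk L (instances ins S) h = emp_risk L (instances ins T) h) \<Longrightarrow>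
          A S = A T"
    \<comment> \<open>the value of v on the empty collection is unconstrained\<close>
    and util: "\<And>S. S \<subseteq> Ddup \<Longrightarrow> S \<noteq> {} \<Longrightarrow> v S = u (A S)"
  shows "(\<forall>i\<in>{1..n}. data_shapley v Ddup (z1 i) = data_shapley v Ddup (z2 i)) \<and>
         (\<Sum>z\<in>D1. data_shapley v Ddup z) = (\<Sum>z\<in>D2. data_shapley v Ddup z) \<and>
         (\<Sum>z\<in>D2. data_shapley v Ddup z) = 1 / 2 * (\<Sum>z\<in>Ddup. data_shapley v Ddup z) \<and>
         1 / 2 * (\<Sum>z\<in>Ddup. data_shapley v Ddup z) = 1 / 2 * (v D1 - v {})"
proof -
  \<comment> \<open>On nonempty collections the utility factors through the risk function: equal
    risks give the same model by \<open>ties\<close>, hence the same utility by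
    \<open>util\<close>.\<close>
  have v_cong: "v S = v T"
    if "S \<subseteq> Ddup" "S \<noteq> {}" "T \<subseteq> Ddup" "T \<noteq> {}"
      and "\<And>h. emp_risk L (instances ins S) h = emp_risk L (instances ins T) h" for S T
    using that ties[of S T] util by simp
  have fin: "finite D1" "finite D2" using D1 D2 by auto
  have swap: "data_shapley v Ddup (z1 i) = data_shapley v Ddup (z2 i)" if i: "i \<in> {1..n}" for i
  proof -
    let ?\<sigma> = "transpose (z1 i) (z2 i)"
    have mem: "z1 i \<in> Ddup" "z2 i \<in> Ddup" using i D1 D2 Ddup by auto
    have im: "?\<sigma> ` Ddup = Ddup"
      using mem by (simp add: transpose_image_eq)
    then have bij: "bij_betw ?\<sigma> Ddup Ddup"
      by (auto simp: bij_betw_def intro: inj_on_subset[OF inj_transpose])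
    have "v (?\<sigma> ` T) = v T" if T: "T \<subseteq> Ddup" for T
    \<comment> \<open>\<open>v_cong\<close> excludes the empty collection, but the swap fixes it, so
      \<open>v {}\<close> may be arbitrary.\<close>
    proof (cases "T = {}")
      case False
      have "?\<sigma> ` T \<subseteq> Ddup" using T im by blast
      moreover have "instances ins (?\<sigma> ` T) = instances ins T"
        using dup[OF i] by (intro instances_transpose) simp
      ultimately show ?thesis using T False by (intro v_cong) auto
    qed simp
    then have "data_shapley v Ddup (?\<sigma> (z1 i)) = data_shapley v Ddup (z1 i)"
      by (intro data_shapley_permute[OF bij mem(1)])
    then show ?thesis by simp
  qed
  have D12: "(\<Sum>z\<in>D1. data_shapley v Ddup z) = (\<Sum>z\<in>D2. data_shapley v Ddup z)"
    unfolding D1(1) D2(1) sum.reindex[OF D1(2)] sum.reindex[OF D2(2)]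
    using swap by (intro sum.cong) auto
  have total: "(\<Sum>z\<in>Ddup. data_shapley v Ddup z) =
      (\<Sum>z\<in>D1. data_shapley v Ddup z) + (\<Sum>z\<in>D2. data_shapley v Ddup z)"
    using sum.union_disjoint[OF fin disj] Ddup by simp
  have vD: "v Ddup = v D1"
  \<comment> \<open>For \<open>n = 0\<close> both collections are empty, so \<open>v_cong\<close>
    does not apply but the two values coincide trivially.\<close>
  proof (cases "n = 0")
    case True
    then show ?thesis using D1 D2 Ddup by simp
  next
    case False
    have "instances ins D2 = instances ins D1"
      unfolding instances_def D1(1) D2(1) sum.reindex[OF D1(2)] sum.reindex[OF D2(2)]
      using dup by (intro sum.cong) auto
    \<comment> \<open>Disjointness of the sources, not of their contents, makes the multiplicities
      add.\<close>
    then have "instances ins Ddup = instances ins D1 + instances ins D1"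
      using sum.union_disjoint[OF fin disj, of ins] Ddup by (simp add: instances_def)
    then show ?thesis
      using False D1 Ddup by (intro v_cong) (auto simp: emp_risk_double)
  qed
  have "(\<Sum>z\<in>Ddup. data_shapley v Ddup z) = v D1 - v {}"
    using data_shapley_efficiency[of Ddup v] fin Ddup vD by simp
  with swap D12 total show ?thesis by auto
qed

end
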